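(* Let $k\in\mathbb{N}$. For all $x\in[0,1]$ except for the dyadic rationals, $$(-1)^{\lfloor 2^kx\rfloor}=\operatorname{sign}\left(\sin(2^k\pi x)\right)=r_k(x).$$
   Context: The Rademacher system is the orthonormal system on $[0,1]$ given by $r_k(x):=\operatorname{sign}(\sin(2^k\pi x))$, $x\in[0,1]$, $k\in\mathbb{N}$. A dyadic rational is a number of the form $m/2^l$ with $m\in\mathbb{Z}$ and $l\in\mathbb{Z}_{\ge0}$. $\lfloor\cdot\rfloor$ is the floor function. *)

theory Defs
  imports "HOL-Analysis.Analysis"
begin

(* The library's dyadics only has natural-number numerators; here all integer
   numerators are allowed. *)
definition dyadic_rationals :: "real set" where
  "dyadic_rationals = {of_int m / 2 ^ l | (m :: int) (l :: nat). True}"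

(* Only the values on the interval [0,1] are meant; the formula is simply left
   unrestricted outside it. *)
definition rademacher :: "nat \<Rightarrow> real \<Rightarrow> real" where
  "rademacher k x = sgn (sin (2 ^ k * pi * x))"

end

theory Submission
  imports Defs
begin

text \<open>
  Dilating by \<open>2 ^ k\<close> reduces the claim to a statement about one real number \<open>y = 2 ^ k * x\<close>: the
  function \<open>y \<mapsto> sin (pi * y)\<close> is positive on \<open>{0<..<1}\<close> and changes sign under \<open>y \<mapsto> y + 1\<close>, so
  between consecutive integers its sign is constant and is given by the parity of \<open>\<lfloor>y\<rfloor>\<close>
  (\<open>sgn_sin_pi_eq_parity_floor\<close>). This fails only at the integers, where the sine vanishes but the
  power of \<open>- 1\<close> does not; and \<open>2 ^ k * x\<close> is an integer only if \<open>x\<close> is a dyadic rational.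
\<close>

text \<open>
  Write \<open>y = \<lfloor>y\<rfloor> + frac y\<close>. Shifting by \<open>\<lfloor>y\<rfloor>\<close> half-periods multiplies the sine by
  \<open>cos (pi * \<lfloor>y\<rfloor>) = (- 1) powi \<lfloor>y\<rfloor>\<close>, and \<open>pi * frac y\<close> lies strictly between \<open>0\<close> and \<open>pi\<close>.
\<close>
lemma sgn_sin_pi_eq_parity_floor:
  fixes y :: real
  assumes "y \<notin> \<int>"
  shows "sgn (sin (pi * y)) = (-1) powi \<lfloor>y\<rfloor>"
proof -
  have "pi * y = pi * of_int \<lfloor>y\<rfloor> + pi * frac y"
    by (simp add: frac_def algebra_simps)
  then have shift: "sin (pi * y) = cos (pi * of_int \<lfloor>y\<rfloor>) * sin (pi * frac y)"
    by (simp only: sin_add sin_npi_int)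
  have "0 < frac y" "frac y < 1"
    using assms by (simp_all add: frac_gt_0_iff frac_lt_1)
  then have "0 < sin (pi * frac y)"
    by (intro sin_gt_zero) simp_all
  then show ?thesis
    by (simp add: shift sgn_mult cos_npi_int power_int_minus_left)
qed

lemma not_Ints_two_power_mult:
  assumes "x \<notin> dyadic_rationals"
  shows "2 ^ k * x \<notin> \<int>"
proof
  assume "2 ^ k * x \<in> \<int>"
  then obtain m where "2 ^ k * x = of_int m"
    by (elim Ints_cases)
  then have "x = of_int m / 2 ^ k"
    by (simp add: field_simps)
  then show False
    using assms unfolding dyadic_rationals_def by blast
qed

theorem theorem2p18:
  fixes k :: nat and x :: real
  assumes "x \<in> {0..1}" and "x \<notin> dyadic_rationals"
  shows "(-1) powi \<lfloor>2 ^ k * x\<rfloor> = sgn (sin (2 ^ k * pi * x))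
    \<and> sgn (sin (2 ^ k * pi * x)) = rademacher k x"
  using sgn_sin_pi_eq_parity_floor[OF not_Ints_two_power_mult[OF assms(2), of k]]
  by (simp add: rademacher_def mult_ac)

end
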